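(* Let $F$ be a ribbon graph, let $\alpha\neq -2,0,1$, $\beta=\alpha(1-\alpha)$ and $\gamma=1/\sqrt{\alpha\beta}$. Then \[ R(F\otimes C_3;\alpha,\beta,\gamma)=(\alpha+2)^{n(F)}\,R\!\left(F;\,\alpha(\alpha+2),\,\frac{\beta}{\alpha+2},\,\gamma\right). \]
   Context: A ribbon graph is a graph with a fixed cyclic order of half-edges at each vertex, regarded as an orientable surface with boundary (vertex discs joined by untwisted edge bands). $v,e,k$ denote numbers of vertices, edges, connected components; $r(H)=v(H)-k(H)$, $n(H)=e(H)-r(H)$; $p(H)$ is the number of boundary components of $H$ as a surface. A state is a spanning sub-ribbon graph (all vertices, a subset of edges); ${\mathcal S}(F)$ is the set of states. Bollobás–Riordan polynomial: $R(F;\alpha,\beta,\gamma)=\sum_{H\in{\mathcal S}(F)}\alpha^{r(F)-r(H)}\beta^{n(H)}\gamma^{k(H)-p(H)+n(H)}$. Tensor product with a cycle: $F\otimes C_p$ is obtained by identifying each edge of $F$ with a distinguished edge of its own copy of the $p$-cycle $C_p$ and then deleting the original edges (a 2-sum with $C_p$ at every edge); equivalently each edge of $F$ is replaced, within its band, by a path of $p-1$ edges through $p-2$ new degree-two vertices. In particular $F\otimes C_3$ is obtained by subdividing every edge of $F$ once. *)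

theory Defs
  imports Complex_Main "HOL-Combinatorics.Orbits"
begin

text \<open>
  Ribbon graphs are encoded by their half-edges (darts): \<open>vert d\<close> is the vertex carrying the
  half-edge \<open>d\<close>, \<open>opp d\<close> is the other half of the edge of \<open>d\<close>, and \<open>rot d\<close> is the successor of
  \<open>d\<close> in the cyclic order at \<open>vert d\<close>. The vertex set is kept separately, since vertices without
  half-edges must be allowed. Loops and multiple edges are allowed.
\<close>

record ('v, 'd) pre_ribbon_graph =
  verts :: "'v set"
  darts :: "'d set"
  vert :: "'d \<Rightarrow> 'v"
  opp :: "'d \<Rightarrow> 'd"
  rot :: "'d \<Rightarrow> 'd"

definition darts_at :: "('v, 'd) pre_ribbon_graph \<Rightarrow> 'v \<Rightarrow> 'd set" where
  "darts_at F v = {d \<in> darts F. vert F d = v}"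

locale ribbon_graph =
  fixes F :: "('v, 'd) pre_ribbon_graph"
  assumes finite_verts: "finite (verts F)"
    and finite_darts: "finite (darts F)"
    and vert_in_verts: "d \<in> darts F \<Longrightarrow> vert F d \<in> verts F"
    and opp_in_darts: "d \<in> darts F \<Longrightarrow> opp F d \<in> darts F"
    and opp_neq: "d \<in> darts F \<Longrightarrow> opp F d \<noteq> d"
    and opp_opp: "d \<in> darts F \<Longrightarrow> opp F (opp F d) = d"
    and rot_cyclic: "v \<in> verts F \<Longrightarrow> darts_at F v \<noteq> {} \<Longrightarrow> cyclic_on (rot F) (darts_at F v)"

definition edges :: "('v, 'd) pre_ribbon_graph \<Rightarrow> 'd set set" where
  "edges F = (\<lambda>d. {d, opp F d}) ` darts F"

definition adjacency :: "('v, 'd) pre_ribbon_graph \<Rightarrow> 'v rel" where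
  "adjacency F = (\<lambda>d. (vert F d, vert F (opp F d))) ` darts F"

definition components :: "('v, 'd) pre_ribbon_graph \<Rightarrow> 'v set set" where
  "components F = verts F // (adjacency F)\<^sup>*"

definition num_v :: "('v, 'd) pre_ribbon_graph \<Rightarrow> int" where
  "num_v F = int (card (verts F))"

definition num_e :: "('v, 'd) pre_ribbon_graph \<Rightarrow> int" where
  "num_e F = int (card (edges F))"

definition num_k :: "('v, 'd) pre_ribbon_graph \<Rightarrow> int" where
  "num_k F = int (card (components F))"

definition rk :: "('v, 'd) pre_ribbon_graph \<Rightarrow> int" where
  "rk F = num_v F - num_k F"

definition nul :: "('v, 'd) pre_ribbon_graph \<Rightarrow> int" where
  "nul F = num_e F - rk F"

text \<open>
  Since the bands are untwisted, a boundary component of the surface that meets some band follows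
  the side of a band from \<open>d\<close> to \<open>opp d\<close> and then the arc of the vertex disc from \<open>opp d\<close> to the next
  half-edge \<open>rot (opp d)\<close>; these components are the orbits of \<open>rot \<circ> opp\<close>, each band side being
  traversed once. Every other boundary component is the boundary circle of the disc of a vertex
  without half-edges.
\<close>

definition boundary_walks :: "('v, 'd) pre_ribbon_graph \<Rightarrow> 'd set set" where
  "boundary_walks F = orbit (rot F \<circ> opp F) ` darts F"

definition isolated_verts :: "('v, 'd) pre_ribbon_graph \<Rightarrow> 'v set" where
  "isolated_verts F = {v \<in> verts F. darts_at F v = {}}"

definition num_p :: "('v, 'd) pre_ribbon_graph \<Rightarrow> int" where
  "num_p F = int (card (boundary_walks F)) + int (card (isolated_verts F))"

text \<open>
  The cyclic order induced on a set \<open>B\<close> of half-edges: the successor of \<open>d\<close> is the first element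
  of \<open>B\<close> met when iterating \<open>rot\<close> from \<open>d\<close>.
\<close>

definition induced_rot :: "('d \<Rightarrow> 'd) \<Rightarrow> 'd set \<Rightarrow> 'd \<Rightarrow> 'd" where
  "induced_rot f B d = (f ^^ (LEAST n. 0 < n \<and> (f ^^ n) d \<in> B)) d"

definition spanning_sub ::
    "('v, 'd) pre_ribbon_graph \<Rightarrow> 'd set set \<Rightarrow> ('v, 'd) pre_ribbon_graph" where
  "spanning_sub F A = F\<lparr>darts := \<Union>A, rot := induced_rot (rot F) (\<Union>A)\<rparr>"

definition states :: "('v, 'd) pre_ribbon_graph \<Rightarrow> ('v, 'd) pre_ribbon_graph set" where
  "states F = {spanning_sub F A | A. A \<subseteq> edges F}"

text \<open>
  The three exponents are non-negative integers for every state of a ribbon graph (the last one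
  is twice the genus), so the integer powers below are ordinary powers.
\<close>

definition BR_poly :: "('v, 'd) pre_ribbon_graph \<Rightarrow> 'a::field \<Rightarrow> 'a \<Rightarrow> 'a \<Rightarrow> 'a" where
  "BR_poly F \<alpha> \<beta> \<gamma> =
     (\<Sum>H\<in>states F. \<alpha> powi (rk F - rk H) * \<beta> powi nul H * \<gamma> powi (num_k H - num_p H + nul H))"

text \<open>
  The tensor product with the \<open>p\<close>-cycle (\<open>p \<ge> 2\<close>): the edge \<open>{d, opp d}\<close> is replaced by a path of
  \<open>p - 1\<close> edges from \<open>vert d\<close> to \<open>vert (opp d)\<close>. With the vertices of this path numbered
  \<open>0, \<dots>, p - 1\<close> starting from \<open>vert d\<close>, the half-edge \<open>(d, i)\<close>, \<open>i < p - 1\<close>, is the one at vertex \<open>i\<close>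
  that points towards vertex \<open>i + 1\<close>. Numbering the path from the other end turns vertex \<open>i\<close> into
  vertex \<open>p - 1 - i\<close>, so the other half of this edge is \<open>(opp d, p - 2 - i)\<close>, and for \<open>i \<ge> 1\<close> the
  other half-edge at vertex \<open>i\<close> is \<open>(opp d, p - 1 - i)\<close>. A new vertex is encoded as the set of its
  two half-edges. The half-edge \<open>(d, 0)\<close> takes the place of \<open>d\<close> in the cyclic order at \<open>vert d\<close>.
\<close>

definition path_vert :: "('v, 'd) pre_ribbon_graph \<Rightarrow> nat \<Rightarrow> 'd \<times> nat \<Rightarrow> ('d \<times> nat) set" where
  "path_vert F p = (\<lambda>(d, i). {(d, i), (opp F d, p - 1 - i)})"

definition tensor_cycle ::
    "('v, 'd) pre_ribbon_graph \<Rightarrow> nat \<Rightarrow> ('v + ('d \<times> nat) set, 'd \<times> nat) pre_ribbon_graph" where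
  "tensor_cycle F p =
     \<lparr>verts = Inl ` verts F \<union> Inr ` path_vert F p ` (darts F \<times> {1..<p - 1}),
      darts = darts F \<times> {..<p - 1},
      vert = (\<lambda>(d, i). if i = 0 then Inl (vert F d) else Inr (path_vert F p (d, i))),
      opp = (\<lambda>(d, i). (opp F d, p - 2 - i)),
      rot = (\<lambda>(d, i). if i = 0 then (rot F d, 0) else (opp F d, p - 1 - i))\<rparr>"

end

theory Submission
  imports Defs
begin

text \<open>
  A state of the subdivided graph keeps both halves, one half or no half of each edge of \<open>F\<close>. Let \<open>H\<close>
  be the state of \<open>F\<close> formed by the edges of which both halves are kept. An edge with a single half
  kept contributes a pendant edge, which changes neither the number of components nor the number of
  boundary components; an edge with no half kept contributes an isolated vertex, which raises both
  by one. So a state over \<open>H\<close> has the nullity and the genus exponent of \<open>H\<close>, and differs from the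
  term of \<open>H\<close> only by a factor \<open>\<alpha>\<close> for each edge with no half kept. Summing over the states above \<open>H\<close>
  gives \<open>(\<alpha> + 2)\<close> to the power \<open>e(F) - e(H) = n(F) + (r(F) - r(H)) - n(H)\<close>, and these three summands
  are absorbed by the prefactor and the new arguments.

  Components and boundary components are counted in the same way: the classes of a partition are
  those that meet a given subset, which are determined by their traces on it, and those that miss it.
  For the orbits of a permutation, the traces on a subset are the orbits of its first-return map.
\<close>

subsection \<open>Partitions\<close>

lemma prod_of_bool:
  "finite A \<Longrightarrow> (\<Prod>x\<in>A. of_bool (P x)) = (of_bool (\<forall>x\<in>A. P x) :: 'a::comm_semiring_1)"
  by (induction A rule: finite_induct) auto

lemma sum_Pow_partition:
  fixes f :: "'a set \<Rightarrow> 'a set \<Rightarrow> 'b::comm_semiring_1"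
  assumes "finite X" and P: "partition_on X P"
  shows "(\<Sum>S\<in>Pow X. \<Prod>C\<in>P. f C (S \<inter> C)) = (\<Prod>C\<in>P. \<Sum>Y\<in>Pow C. f C Y)"
proof -
  have "finite P" using assms by (rule finite_elements)
  have X_eq: "X = \<Union>P" using P by (rule partition_onD1)
  have "finite C" if "C \<in> P" for C
    using that X_eq \<open>finite X\<close> by (metis Union_upper finite_subset)
  with \<open>finite P\<close> have "(\<Prod>C\<in>P. \<Sum>Y\<in>Pow C. f C Y) = (\<Sum>g\<in>Pi\<^sub>E P Pow. \<Prod>C\<in>P. f C (g C))"
    by (intro prod_sum_PiE) auto
  also have "\<dots> = (\<Sum>S\<in>Pow X. \<Prod>C\<in>P. f C (S \<inter> C))"
  proof (rule sum.reindex_bij_witness[where i = "\<lambda>S. \<lambda>C\<in>P. S \<inter> C" and j = "\<lambda>g. \<Union>C\<in>P. g C"])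
    fix g assume g: "g \<in> Pi\<^sub>E P Pow"
    have trace: "(\<Union>C'\<in>P. g C') \<inter> C = g C" if "C \<in> P" for C
    proof -
      have "g C' \<subseteq> C'" if "C' \<in> P" for C' using g that by (auto simp: PiE_iff)
      then show ?thesis
        using \<open>C \<in> P\<close> partition_onD2[OF P] by (fastforce simp: disjoint_def)
    qed
    then show "(\<lambda>C\<in>P. (\<Union>C'\<in>P. g C') \<inter> C) = g"
      using g by (intro PiE_ext[of _ P Pow g]) auto
    show "(\<Union>C\<in>P. g C) \<in> Pow X" using g X_eq by (auto simp: PiE_iff)
    show "(\<Prod>C\<in>P. f C ((\<Union>C'\<in>P. g C') \<inter> C)) = (\<Prod>C\<in>P. f C (g C))"
      using trace by (intro prod.cong refl) simp
  qed (auto simp: X_eq)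
  finally show ?thesis ..
qed

lemma card_classes_eq_traces_plus_missing:
  assumes "finite X" "B \<subseteq> X"
    and refl: "\<And>x. x \<in> X \<Longrightarrow> x \<in> K x"
    and class_eq: "\<And>x y. x \<in> X \<Longrightarrow> y \<in> K x \<Longrightarrow> K y = K x"
  shows "card (K ` X) = card ((\<lambda>x. K x \<inter> B) ` B) + card {C \<in> K ` X. C \<inter> B = {}}"
proof -
  have "K x \<in> K ` B" if "x \<in> X" "K x \<inter> B \<noteq> {}" for x
    using that class_eq[of x] by blast
  then have "K ` X = K ` B \<union> {C \<in> K ` X. C \<inter> B = {}}"
    using \<open>B \<subseteq> X\<close> by blast
  moreover have "K ` B \<inter> {C \<in> K ` X. C \<inter> B = {}} = {}"
    using \<open>B \<subseteq> X\<close> refl by blast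
  moreover have "finite B" using \<open>finite X\<close> \<open>B \<subseteq> X\<close> by (rule rev_finite_subset)
  ultimately have "card (K ` X) = card (K ` B) + card {C \<in> K ` X. C \<inter> B = {}}"
    using \<open>finite X\<close> by (metis (no_types, lifting) card_Un_disjoint finite_Un finite_imageI)
  moreover have "inj_on (\<lambda>C. C \<inter> B) (K ` B)"
  proof (rule inj_onI, clarify)
    fix x y assume xy: "x \<in> B" "y \<in> B" "K x \<inter> B = K y \<inter> B"
    then have "x \<in> K y" using refl \<open>B \<subseteq> X\<close> by blast
    then show "K x = K y" using class_eq xy(2) \<open>B \<subseteq> X\<close> by blast
  qed
  then have "card (K ` B) = card ((\<lambda>x. K x \<inter> B) ` B)"
    using card_image by (fastforce simp: image_image)
  ultimately show ?thesis by simp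
qed

subsection \<open>Orbits and first-return maps\<close>

lemma self_in_orbit_eq:
  assumes "x \<in> orbit f x" "y \<in> orbit f x"
  shows "orbit f y = orbit f x"
  using assms orbit_swap[OF assms] by (blast intro: orbit_trans)

lemma orbit_involution:
  assumes "f (f x) = x"
  shows "orbit f x = {x, f x}"
proof -
  have "(f ^^ 2) x = x" using assms by (simp add: numeral_2_eq_2)
  then have "orbit f x = {(f ^^ m) x | m. m < 2}" by (rule orbit_altdef_bounded) simp
  also have "\<dots> = {x, f x}"
    by (auto simp: less_2_cases_iff intro: exI[of _ "0::nat"] exI[of _ "1::nat"])
  finally show ?thesis .
qed

lemma orbit_subset_of_funcset:
  assumes "f \<in> X \<rightarrow> X" "x \<in> X"
  shows "orbit f x \<subseteq> X"
proof
  fix y assume "y \<in> orbit f x"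
  then show "y \<in> X" by induction (use assms in auto)
qed

lemma bij_betw_iff_self_in_orbit:
  assumes "finite X" and maps: "f \<in> X \<rightarrow> X"
  shows "bij_betw f X X \<longleftrightarrow> (\<forall>x\<in>X. x \<in> orbit f x)"
proof
  assume bij: "bij_betw f X X"
  define g where "g = perm_restrict f X"
  have "bij_betw g X X"
    using bij by (rule bij_betw_cong[THEN iffD1, rotated]) (simp add: g_def perm_restrict_def)
  then have "g permutes X"
    by (rule bij_imp_permutes) (simp add: g_def perm_restrict_def)
  then have "permutation g" using \<open>finite X\<close> by (auto simp: permutation_permutes)
  moreover have "orbit f x = orbit g x" if "x \<in> X" for x
    using that maps by (rule orbit_cong0) (simp add: g_def perm_restrict_def)
  ultimately show "\<forall>x\<in>X. x \<in> orbit f x" by (simp add: permutation_self_in_orbit)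
next
  assume self: "\<forall>x\<in>X. x \<in> orbit f x"
  have "X \<subseteq> f ` X"
  proof
    fix x assume x: "x \<in> X"
    with self have "x \<in> orbit f x" by blast
    then show "x \<in> f ` X"
      by cases (use x orbit_subset_of_funcset[OF maps x] in auto)
  qed
  with maps have "f ` X = X" by blast
  then show "bij_betw f X X"
    using \<open>finite X\<close> finite_surj_inj[of X f] by (simp add: bij_betw_def)
qed

lemma bij_betw_self_in_orbit:
  assumes "finite X" "bij_betw f X X" "x \<in> X"
  shows "x \<in> orbit f x"
  using assms bij_betw_iff_self_in_orbit[of X f] bij_betw_imp_funcset by blast

lemma induced_rot_eqI:
  assumes "0 < n" "(f ^^ n) d \<in> B" "\<And>m. 0 < m \<Longrightarrow> m < n \<Longrightarrow> (f ^^ m) d \<notin> B"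
  shows "induced_rot f B d = (f ^^ n) d"
proof -
  have "(LEAST n. 0 < n \<and> (f ^^ n) d \<in> B) = n"
    using assms by (intro Least_equality) (auto simp flip: not_less)
  then show ?thesis by (simp add: induced_rot_def)
qed

lemma first_return_time:
  assumes "e \<in> orbit f d" "e \<in> B"
  obtains n where "0 < n" "(f ^^ n) d \<in> B" "\<And>m. 0 < m \<Longrightarrow> m < n \<Longrightarrow> (f ^^ m) d \<notin> B"
    "induced_rot f B d = (f ^^ n) d"
proof -
  let ?returns = "\<lambda>n. 0 < n \<and> (f ^^ n) d \<in> B"
  let ?n = "LEAST n. ?returns n"
  have "\<exists>n. ?returns n" using assms by (auto simp: orbit_altdef)
  then have "?returns ?n" by (rule LeastI_ex)
  moreover have "(f ^^ m) d \<notin> B" if "0 < m" "m < ?n" for m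
    using that not_less_Least[of m ?returns] by blast
  ultimately show ?thesis using that induced_rot_def[of f B d] by blast
qed

lemma induced_rot_comp:
  assumes return: "e \<in> orbit f (g d)" "e \<in> B" and g: "\<And>x. x \<notin> B \<Longrightarrow> g x = x"
  shows "induced_rot (f \<circ> g) B d = induced_rot f B (g d)"
proof -
  obtain n where n: "0 < n" "(f ^^ n) (g d) \<in> B" "\<And>m. 0 < m \<Longrightarrow> m < n \<Longrightarrow> (f ^^ m) (g d) \<notin> B"
    "induced_rot f B (g d) = (f ^^ n) (g d)"
    using return by (rule first_return_time) blast
  have iterate: "((f \<circ> g) ^^ m) d = (f ^^ m) (g d)" if "0 < m" "m \<le> n" for m
    using that
  proof (induction m)
    case (Suc m)
    then show ?case by (cases "m = 0") (simp_all add: g n(3))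
  qed simp
  have "induced_rot (f \<circ> g) B d = ((f \<circ> g) ^^ n) d"
    using n by (intro induced_rot_eqI) (simp_all add: iterate)
  also have "\<dots> = induced_rot f B (g d)"
    using n by (simp add: iterate)
  finally show ?thesis .
qed

lemma funpow_in_orbit_induced_rot:
  assumes "0 < n" "(f ^^ n) d \<in> B"
  shows "(f ^^ n) d \<in> orbit (induced_rot f B) d"
  using assms
proof (induction n arbitrary: d rule: less_induct)
  case (less n)
  have "(f ^^ n) d \<in> orbit f d" using less.prems by (auto simp: orbit_altdef)
  then obtain k where k: "0 < k" "(f ^^ k) d \<in> B" "\<And>m. 0 < m \<Longrightarrow> m < k \<Longrightarrow> (f ^^ m) d \<notin> B"
    and return: "induced_rot f B d = (f ^^ k) d"
    using less.prems(2) by (rule first_return_time) blast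
  have "k \<le> n" using k(3)[of n] less.prems by force
  then consider (first) "k = n" | (later) "k < n" by linarith
  then show ?case
  proof cases
    case first
    then show ?thesis using return orbit.base by metis
  next
    case later
    have after_return: "(f ^^ n) d = (f ^^ (n - k)) (induced_rot f B d)"
      using \<open>k \<le> n\<close> unfolding return
      by (simp flip: funpow_add[THEN fun_cong, unfolded comp_apply])
    have "(f ^^ (n - k)) (induced_rot f B d) \<in> orbit (induced_rot f B) (induced_rot f B d)"
      using later k(1) less.prems(2) by (intro less.IH) (simp_all flip: after_return)
    then show ?thesis unfolding after_return by (rule orbit_subset)
  qed
qed

lemma orbit_induced_rot:
  assumes self: "d \<in> orbit f d" and "d \<in> B"
  shows "orbit (induced_rot f B) d = orbit f d \<inter> B"
proof (intro subset_antisym subsetI)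
  fix y assume "y \<in> orbit (induced_rot f B) d"
  moreover have "induced_rot f B x \<in> orbit f d \<inter> B" if x: "x \<in> orbit f d" "x \<in> B" for x
  proof -
    have "x \<in> orbit f x" using self x(1) by (rule self_in_orbit_trans)
    from this x(2) obtain n where "(f ^^ n) x \<in> B" "induced_rot f B x = (f ^^ n) x"
      by (rule first_return_time) blast
    then show ?thesis using x(1) by (simp add: funpow_in_orbit)
  qed
  ultimately show "y \<in> orbit f d \<inter> B"
    by induction (use self \<open>d \<in> B\<close> in simp_all)
next
  fix y assume "y \<in> orbit f d \<inter> B"
  then obtain n where "0 < n" "y = (f ^^ n) d" "y \<in> B" by (auto simp: orbit_altdef)
  then show "y \<in> orbit (induced_rot f B) d"
    using funpow_in_orbit_induced_rot by metis
qed

lemma card_orbits_induced_rot: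
  assumes "finite X" "bij_betw f X X" "B \<subseteq> X"
  shows "card (orbit f ` X)
    = card (orbit (induced_rot f B) ` B) + card {C \<in> orbit f ` X. C \<inter> B = {}}"
proof -
  have self: "x \<in> orbit f x" if "x \<in> X" for x
    using assms(1,2) that by (rule bij_betw_self_in_orbit)
  then have "orbit (induced_rot f B) ` B = (\<lambda>x. orbit f x \<inter> B) ` B"
    using \<open>B \<subseteq> X\<close> by (intro image_cong refl orbit_induced_rot) auto
  moreover have "card (orbit f ` X)
      = card ((\<lambda>x. orbit f x \<inter> B) ` B) + card {C \<in> orbit f ` X. C \<inter> B = {}}"
    using assms(1,3) self self_in_orbit_eq[OF self] by (rule card_classes_eq_traces_plus_missing)
  ultimately show ?thesis by simp
qed

subsection \<open>Ribbon graphs and their states\<close>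

lemma spanning_sub_simps [simp]:
  "verts (spanning_sub F A) = verts F" "darts (spanning_sub F A) = \<Union>A"
  "vert (spanning_sub F A) = vert F" "opp (spanning_sub F A) = opp F"
  "rot (spanning_sub F A) = induced_rot (rot F) (\<Union>A)"
  by (simp_all add: spanning_sub_def)

lemma darts_at_spanning_sub:
  "\<Union>A \<subseteq> darts F \<Longrightarrow> darts_at (spanning_sub F A) v = darts_at F v \<inter> \<Union>A"
  by (auto simp: darts_at_def)

definition component_of :: "('v, 'd) pre_ribbon_graph \<Rightarrow> 'v \<Rightarrow> 'v set" where
  "component_of F v = (adjacency F)\<^sup>* `` {v}"

lemma components_eq_component_of: "components F = component_of F ` verts F"
  by (auto simp: components_def quotient_def component_of_def)

lemma self_in_component_of: "v \<in> component_of F v"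
  by (simp add: component_of_def)

lemma component_of_step:
  "w \<in> component_of F v \<Longrightarrow> (w, u) \<in> adjacency F \<Longrightarrow> u \<in> component_of F v"
  by (auto simp: component_of_def intro: rtrancl_into_rtrancl)

text \<open>
  The boundary walks of the state with edge set \<open>A\<close>, traced on all half-edges of \<open>F\<close>: a half-edge
  whose edge is not kept is passed as a mere mark on the boundary of its vertex disc.
\<close>

definition boundary_perm :: "('v, 'd) pre_ribbon_graph \<Rightarrow> 'd set set \<Rightarrow> 'd \<Rightarrow> 'd" where
  "boundary_perm F A = rot F \<circ> perm_restrict (opp F) (\<Union>A)"

lemma boundary_perm_simps:
  "d \<in> \<Union>A \<Longrightarrow> boundary_perm F A d = rot F (opp F d)"
  "d \<notin> \<Union>A \<Longrightarrow> boundary_perm F A d = rot F d"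
  by (simp_all add: boundary_perm_def perm_restrict_def)

definition state_weight ::
    "'a::field \<Rightarrow> 'a \<Rightarrow> 'a \<Rightarrow> ('v, 'd) pre_ribbon_graph \<Rightarrow> ('v, 'd) pre_ribbon_graph \<Rightarrow> 'a" where
  "state_weight a b c F H =
    a powi (rk F - rk H) * b powi nul H * c powi (num_k H - num_p H + nul H)"

context ribbon_graph
begin

lemma finite_edges: "finite (edges F)"
  by (simp add: edges_def finite_darts)

lemma edge_of_dart: "d \<in> darts F \<Longrightarrow> {d, opp F d} \<in> edges F"
  by (simp add: edges_def)

lemma edgeE:
  assumes "e \<in> edges F"
  obtains d where "d \<in> darts F" "e = {d, opp F d}"
  using assms by (auto simp: edges_def)

lemma edge_eqI: "e \<in> edges F \<Longrightarrow> d \<in> e \<Longrightarrow> e = {d, opp F d}"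
  by (auto simp: edges_def opp_opp)

lemma partition_on_edges: "partition_on (darts F) (edges F)"
proof (rule partition_onI)
  show "\<Union>(edges F) = darts F" by (auto simp: edges_def opp_in_darts)
  show "disjnt e e'" if "e \<in> edges F" "e' \<in> edges F" "e \<noteq> e'" for e e'
    using that edge_eqI by (metis disjnt_iff)
qed (auto simp: edges_def)

lemmas Union_edges = partition_onD1[OF partition_on_edges, symmetric]

lemma Union_edges_subset: "A \<subseteq> edges F \<Longrightarrow> \<Union>A \<subseteq> darts F"
  using Union_edges by blast

lemma opp_in_Union_edges: "A \<subseteq> edges F \<Longrightarrow> d \<in> \<Union>A \<Longrightarrow> opp F d \<in> \<Union>A"
  using edge_eqI by blast

lemma edges_spanning_sub:
  assumes "A \<subseteq> edges F"
  shows "edges (spanning_sub F A) = A"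
proof -
  have edge_eq: "{d, opp F d} = e" if "d \<in> e" "e \<in> A" for d e
    using that assms edge_eqI[of e d] by blast
  have "e \<in> (\<lambda>d. {d, opp F d}) ` \<Union>A" if e: "e \<in> A" for e
  proof -
    from e assms obtain d where "d \<in> e" by (blast elim: edgeE)
    with e edge_eq[of d e] show ?thesis by (intro image_eqI[of _ _ d]) auto
  qed
  with edge_eq have "(\<lambda>d. {d, opp F d}) ` \<Union>A = A" by auto
  then show ?thesis by (simp add: edges_def)
qed

lemma inj_spanning_sub: "inj_on (spanning_sub F) (Pow (edges F))"
  by (rule inj_on_inverseI[of _ edges]) (simp add: edges_spanning_sub)

lemma BR_poly_eq_sum_Pow_edges:
  "BR_poly F a b c = (\<Sum>A\<in>Pow (edges F). state_weight a b c F (spanning_sub F A))"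
proof -
  have "states F = spanning_sub F ` Pow (edges F)" by (auto simp: states_def)
  then show ?thesis
    by (simp add: BR_poly_def state_weight_def sum.reindex[OF inj_spanning_sub])
qed

lemma num_v_spanning_sub: "num_v (spanning_sub F A) = num_v F"
  by (simp add: num_v_def)

lemma num_e_spanning_sub: "A \<subseteq> edges F \<Longrightarrow> num_e (spanning_sub F A) = int (card A)"
  by (simp add: num_e_def edges_spanning_sub)

lemma orbit_rot: "d \<in> darts F \<Longrightarrow> orbit (rot F) d = darts_at F (vert F d)"
  by (rule orbit_cyclic_eq3, rule rot_cyclic) (auto simp: darts_at_def vert_in_verts)

lemma self_in_orbit_rot: "d \<in> darts F \<Longrightarrow> d \<in> orbit (rot F) d"
  by (simp add: orbit_rot darts_at_def)

lemma bij_betw_rot: "bij_betw (rot F) (darts F) (darts F)"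
proof -
  have "rot F \<in> darts F \<rightarrow> darts F"
    using orbit_rot orbit.base[of "rot F"] by (fastforce simp: darts_at_def)
  then show ?thesis
    using finite_darts self_in_orbit_rot by (simp add: bij_betw_iff_self_in_orbit)
qed

lemma ribbon_graph_spanning_sub:
  assumes A: "A \<subseteq> edges F"
  shows "ribbon_graph (spanning_sub F A)"
proof
  fix v assume v: "v \<in> verts (spanning_sub F A)" "darts_at (spanning_sub F A) v \<noteq> {}"
  note at = darts_at_spanning_sub[OF Union_edges_subset[OF A]]
  from v(2) obtain d where d: "d \<in> darts F" "vert F d = v" "d \<in> \<Union>A"
    unfolding at by (auto simp: darts_at_def)
  have "orbit (induced_rot (rot F) (\<Union>A)) d = darts_at F v \<inter> \<Union>A"
    using self_in_orbit_rot[OF d(1)] d by (simp add: orbit_induced_rot orbit_rot)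
  moreover have "d \<in> darts_at F v \<inter> \<Union>A" using d by (simp add: darts_at_def)
  ultimately show "cyclic_on (rot (spanning_sub F A)) (darts_at (spanning_sub F A) v)"
    by (auto simp: at cyclic_on_def)
qed (use Union_edges_subset[OF A] opp_in_Union_edges[OF A] in
    \<open>auto simp: finite_verts vert_in_verts opp_neq opp_opp intro: finite_subset[OF _ finite_darts]\<close>)

lemma component_of_subset_verts:
  assumes "v \<in> verts F"
  shows "component_of F v \<subseteq> verts F"
proof
  fix w assume "w \<in> component_of F v"
  then have "(v, w) \<in> (adjacency F)\<^sup>*" by (simp add: component_of_def)
  then show "w \<in> verts F"
    by induction (use assms in \<open>auto simp: adjacency_def vert_in_verts opp_in_darts\<close>)
qed

lemma sym_adjacency: "sym (adjacency F)"
  by (rule symI)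
    (auto simp: adjacency_def image_iff opp_opp intro!: bexI[of _ "opp F _"] opp_in_darts)

lemma component_of_eq:
  assumes "w \<in> component_of F v"
  shows "component_of F w = component_of F v"
proof -
  have "equiv UNIV ((adjacency F)\<^sup>*)"
    by (simp add: equiv_def refl_rtrancl trans_rtrancl sym_rtrancl sym_adjacency)
  then show ?thesis
    using assms unfolding component_of_def by (auto dest: equiv_class_eq)
qed

lemma bij_betw_boundary_perm:
  assumes "A \<subseteq> edges F"
  shows "bij_betw (boundary_perm F A) (darts F) (darts F)"
proof -
  have "bij_betw (perm_restrict (opp F) (\<Union>A)) (darts F) (darts F)"
    using opp_in_Union_edges[OF assms]
    by (intro bij_betw_byWitness[of _ "perm_restrict (opp F) (\<Union>A)"])
      (auto simp: perm_restrict_def opp_opp opp_in_darts)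
  then show ?thesis
    unfolding boundary_perm_def using bij_betw_rot by (rule bij_betw_trans)
qed

lemma boundary_walks_spanning_sub:
  assumes A: "A \<subseteq> edges F"
  shows "boundary_walks (spanning_sub F A)
    = orbit (induced_rot (boundary_perm F A) (\<Union>A)) ` \<Union>A"
  unfolding boundary_walks_def spanning_sub_simps
proof (rule image_cong[OF refl])
  let ?\<psi> = "boundary_perm F A"
  have darts: "\<Union>A \<subseteq> darts F" using A by (rule Union_edges_subset)
  have step: "induced_rot (rot F) (\<Union>A) (opp F d) = induced_rot ?\<psi> (\<Union>A) d" if d: "d \<in> \<Union>A" for d
  proof -
    have opp: "opp F d \<in> \<Union>A" using A d by (rule opp_in_Union_edges)
    then have "opp F d \<in> orbit (rot F) (perm_restrict (opp F) (\<Union>A) d)"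
      using d darts by (simp add: perm_restrict_simps self_in_orbit_rot subsetD)
    then have "induced_rot ?\<psi> (\<Union>A) d = induced_rot (rot F) (\<Union>A) (perm_restrict (opp F) (\<Union>A) d)"
      unfolding boundary_perm_def using opp by (rule induced_rot_comp) (rule perm_restrict_simps)
    then show ?thesis using d by (simp add: perm_restrict_simps)
  qed
  fix d assume d: "d \<in> \<Union>A"
  then have "d \<in> orbit ?\<psi> d"
    using bij_betw_self_in_orbit[OF finite_darts bij_betw_boundary_perm[OF A]] darts by blast
  from orbit_induced_rot[OF this d]
  show "orbit (induced_rot (rot F) (\<Union>A) \<circ> opp F) d = orbit (induced_rot ?\<psi> (\<Union>A)) d"
    using d \<open>d \<in> orbit ?\<psi> d\<close> by (intro orbit_cong) (simp_all add: step)
qed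

lemma orbit_boundary_perm_missing:
  assumes A: "A \<subseteq> edges F" and d: "d \<in> darts F"
    and missing: "orbit (boundary_perm F A) d \<inter> \<Union>A = {} \<or> darts_at F (vert F d) \<inter> \<Union>A = {}"
  shows "orbit (boundary_perm F A) d = darts_at F (vert F d)"
proof -
  let ?\<psi> = "boundary_perm F A"
  have "orbit ?\<psi> d = orbit (rot F) d"
    using missing
  proof
    assume "orbit ?\<psi> d \<inter> \<Union>A = {}"
    then have "rot F x = ?\<psi> x" if "x \<in> orbit ?\<psi> d" for x
      using that boundary_perm_simps(2) by (metis disjoint_iff)
    with bij_betw_self_in_orbit[OF finite_darts bij_betw_boundary_perm[OF A] d]
    show ?thesis by (rule orbit_cong[symmetric])
  next
    assume "darts_at F (vert F d) \<inter> \<Union>A = {}"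
    then have "?\<psi> x = rot F x" if "x \<in> orbit (rot F) d" for x
      using that orbit_rot[OF d] boundary_perm_simps(2) by (metis disjoint_iff)
    with self_in_orbit_rot[OF d] show ?thesis by (rule orbit_cong)
  qed
  then show ?thesis by (simp only: orbit_rot[OF d])
qed

lemma orbits_boundary_perm_missing:
  assumes A: "A \<subseteq> edges F"
  shows "{C \<in> orbit (boundary_perm F A) ` darts F. C \<inter> \<Union>A = {}}
    = darts_at F ` {v \<in> verts F. darts_at F v \<noteq> {} \<and> darts_at F v \<inter> \<Union>A = {}}"
    (is "?missing = darts_at F ` ?bare")
proof (intro subset_antisym subsetI)
  fix C assume "C \<in> ?missing"
  then obtain d where d: "d \<in> darts F" "C = orbit (boundary_perm F A) d" "C \<inter> \<Union>A = {}" by blast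
  then have "C = darts_at F (vert F d)" using orbit_boundary_perm_missing[OF A] by blast
  moreover from this have "vert F d \<in> ?bare"
    using d orbit_nonempty vert_in_verts by (metis (mono_tags, lifting) mem_Collect_eq)
  ultimately show "C \<in> darts_at F ` ?bare" by (rule image_eqI)
next
  fix C assume "C \<in> darts_at F ` ?bare"
  then obtain d where "d \<in> darts F" "C = darts_at F (vert F d)" "C \<inter> \<Union>A = {}"
    by (auto simp: darts_at_def)
  moreover from this have "C = orbit (boundary_perm F A) d"
    using orbit_boundary_perm_missing[OF A, of d] by simp
  ultimately show "C \<in> ?missing" by blast
qed

lemma num_p_spanning_sub:
  assumes A: "A \<subseteq> edges F"
  shows "num_p (spanning_sub F A)
    = int (card (orbit (boundary_perm F A) ` darts F)) + int (card (isolated_verts F))"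
proof -
  let ?bare = "{v \<in> verts F. darts_at F v \<noteq> {} \<and> darts_at F v \<inter> \<Union>A = {}}"
  note darts = Union_edges_subset[OF A]
  have "inj_on (darts_at F) ?bare" by (rule inj_onI) (auto simp: darts_at_def)
  then have "card (orbit (boundary_perm F A) ` darts F)
      = card (boundary_walks (spanning_sub F A)) + card ?bare"
    using card_orbits_induced_rot[OF finite_darts bij_betw_boundary_perm[OF A] darts]
    by (simp add: boundary_walks_spanning_sub[OF A] orbits_boundary_perm_missing[OF A] card_image)
  moreover have "isolated_verts (spanning_sub F A) = isolated_verts F \<union> ?bare"
    by (auto simp: isolated_verts_def darts_at_spanning_sub[OF darts])
  moreover have "card (isolated_verts F \<union> ?bare) = card (isolated_verts F) + card ?bare"
    using finite_verts by (intro card_Un_disjoint) (auto simp: isolated_verts_def)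
  ultimately show ?thesis by (simp add: num_p_def)
qed

end

subsection \<open>The subdivided graph\<close>

lemma tensor_cycle_simps [simp]:
  "verts (tensor_cycle F p) = Inl ` verts F \<union> Inr ` path_vert F p ` (darts F \<times> {1..<p - 1})"
  "opp (tensor_cycle F p) (d, i) = (opp F d, p - 2 - i)"
  "rot (tensor_cycle F p) (d, i) = (if i = 0 then (rot F d, 0) else (opp F d, p - 1 - i))"
  "darts (tensor_cycle F p) = darts F \<times> {..<p - 1}"
  by (simp_all add: tensor_cycle_def)

lemma vert_tensor_cycle:
  "vert (tensor_cycle F p) x = (if snd x = 0 then Inl (vert F (fst x)) else Inr (path_vert F p x))"
  by (cases x) (simp add: tensor_cycle_def)

context ribbon_graph
begin

lemma darts_at_tensor_cycle_Inl:
  "darts_at (tensor_cycle F p) (Inl v) = (if p \<le> 1 then {} else (\<lambda>d. (d, 0)) ` darts_at F v)"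
  by (auto simp: darts_at_def vert_tensor_cycle split: if_splits)

lemma darts_at_tensor_cycle_Inr:
  assumes "d \<in> darts F" "0 < i" "i < p - 1"
  shows "darts_at (tensor_cycle F p) (Inr (path_vert F p (d, i))) = {(d, i), (opp F d, p - 1 - i)}"
proof -
  have "path_vert F p x = path_vert F p (d, i) \<longleftrightarrow> x \<in> {(d, i), (opp F d, p - 1 - i)}" for x
    using assms by (cases x) (auto simp: path_vert_def doubleton_eq_iff opp_opp)
  then show ?thesis
    using assms by (auto simp: darts_at_def vert_tensor_cycle opp_in_darts)
qed

lemma isolated_verts_tensor_cycle:
  assumes "1 < p"
  shows "isolated_verts (tensor_cycle F p) = Inl ` isolated_verts F"
proof -
  have "darts_at (tensor_cycle F p) (Inr y) \<noteq> {}"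
    if "y \<in> path_vert F p ` (darts F \<times> {1..<p - 1})" for y
  proof -
    from that obtain d i where "(d, i) \<in> darts F \<times> {1..<p - 1}" "y = path_vert F p (d, i)" by blast
    then show ?thesis using darts_at_tensor_cycle_Inr[of d i p] by auto
  qed
  moreover have "darts_at (tensor_cycle F p) (Inl v) = {} \<longleftrightarrow> darts_at F v = {}" for v
    using assms by (simp add: darts_at_tensor_cycle_Inl)
  ultimately show ?thesis unfolding isolated_verts_def tensor_cycle_simps by blast
qed

lemma ribbon_graph_tensor_cycle: "ribbon_graph (tensor_cycle F p)"
proof
  let ?G = "tensor_cycle F p"
  fix x assume x: "x \<in> verts ?G" "darts_at ?G x \<noteq> {}"
  from x(1) have "x \<in> Inl ` verts F \<or> x \<in> Inr ` path_vert F p ` (darts F \<times> {1..<p - 1})"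
    by simp
  then show "cyclic_on (rot ?G) (darts_at ?G x)"
  proof
    assume "x \<in> Inl ` verts F"
    then obtain v where v: "v \<in> verts F" "x = Inl v" by blast
    with x(2) have at: "darts_at ?G x = (\<lambda>d. (d, 0)) ` darts_at F v" "darts_at F v \<noteq> {}"
      by (auto simp: darts_at_tensor_cycle_Inl split: if_splits)
    show ?thesis
      unfolding at(1) using rot_cyclic[OF v(1) at(2)] by (rule cyclic_on_image) simp
  next
    assume "x \<in> Inr ` path_vert F p ` (darts F \<times> {1..<p - 1})"
    then obtain d i where "(d, i) \<in> darts F \<times> {1..<p - 1}"
      and x_eq: "x = Inr (path_vert F p (d, i))"
      by blast
    then have d: "d \<in> darts F" "0 < i" "i < p - 1" by auto
    have "orbit (rot ?G) (d, i) = {(d, i), (opp F d, p - 1 - i)}"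
      using d by (subst orbit_involution) (auto simp: opp_opp)
    then show ?thesis
      unfolding x_eq darts_at_tensor_cycle_Inr[OF d] by (auto simp: cyclic_on_def)
  qed
qed (auto simp: vert_tensor_cycle finite_verts finite_darts vert_in_verts
    opp_in_darts opp_neq opp_opp)

end

abbreviation subdivision ::
    "('v, 'd) pre_ribbon_graph \<Rightarrow> ('v + ('d \<times> nat) set, 'd \<times> nat) pre_ribbon_graph" where
  "subdivision F \<equiv> tensor_cycle F 3"

text \<open>
  Each half-edge \<open>d\<close> of \<open>F\<close> yields one edge of the subdivided graph, the half at \<open>vert d\<close> of the edge
  of \<open>d\<close>; hence the states of the subdivided graph correspond to the sets of half-edges of \<open>F\<close>.
\<close>

definition near_edge :: "('v, 'd) pre_ribbon_graph \<Rightarrow> 'd \<Rightarrow> ('d \<times> nat) set" where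
  "near_edge F d = {(d, 0), (opp F d, 1)}"

definition midpoint :: "'d set \<Rightarrow> 'v + ('d \<times> nat) set" where
  "midpoint e = Inr (e \<times> {1})"

abbreviation subdivision_state ::
    "('v, 'd) pre_ribbon_graph \<Rightarrow> 'd set \<Rightarrow> ('v + ('d \<times> nat) set, 'd \<times> nat) pre_ribbon_graph" where
  "subdivision_state F S \<equiv> spanning_sub (subdivision F) (near_edge F ` S)"

definition full_edges :: "('v, 'd) pre_ribbon_graph \<Rightarrow> 'd set \<Rightarrow> 'd set set" where
  "full_edges F S = {e \<in> edges F. e \<subseteq> S}"

definition empty_edges :: "('v, 'd) pre_ribbon_graph \<Rightarrow> 'd set \<Rightarrow> 'd set set" where
  "empty_edges F S = {e \<in> edges F. e \<inter> S = {}}"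

abbreviation full_state ::
    "('v, 'd) pre_ribbon_graph \<Rightarrow> 'd set \<Rightarrow> ('v, 'd) pre_ribbon_graph" where
  "full_state F S \<equiv> spanning_sub F (full_edges F S)"

lemma full_edges_subset: "full_edges F S \<subseteq> edges F"
  by (auto simp: full_edges_def)

lemma midpoint_neq_Inl [simp]: "midpoint e \<noteq> Inl v" "Inl v \<noteq> midpoint e"
  by (simp_all add: midpoint_def)

lemma midpoint_eq_iff [simp]: "midpoint e = midpoint e' \<longleftrightarrow> e = e'"
  by (auto simp: midpoint_def)

lemma inj_on_midpoint [simp]: "inj_on midpoint E"
  by (simp add: inj_on_def)

lemma vert_subdivision [simp]:
  "vert (subdivision F) (d, 0) = Inl (vert F d)"
  "vert (subdivision F) (d, Suc 0) = midpoint {d, opp F d}"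
  by (auto simp: vert_tensor_cycle midpoint_def path_vert_def)

lemma inj_on_near_edge: "inj_on (near_edge F) S"
  by (rule inj_onI) (auto simp: near_edge_def doubleton_eq_iff)

context ribbon_graph
begin

lemma mem_Union_full_edges:
  assumes "S \<subseteq> darts F"
  shows "d \<in> \<Union>(full_edges F S) \<longleftrightarrow> d \<in> S \<and> opp F d \<in> S"
  using assms by (force simp: full_edges_def edges_def opp_opp)

lemma verts_subdivision: "verts (subdivision F) = Inl ` verts F \<union> midpoint ` edges F"
proof -
  have "path_vert F 3 (d, 1) = {d, opp F d} \<times> {1}" for d
    by (auto simp: path_vert_def)
  moreover have "{1..<3 - 1::nat} = {1}" by auto
  ultimately show ?thesis
    by (auto simp: edges_def midpoint_def image_iff)
qed

lemma mem_Union_near_edges: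
  assumes "S \<subseteq> darts F"
  shows "(d, 0) \<in> \<Union>(near_edge F ` S) \<longleftrightarrow> d \<in> S"
    and "d \<in> darts F \<Longrightarrow> (d, Suc 0) \<in> \<Union>(near_edge F ` S) \<longleftrightarrow> opp F d \<in> S"
  using assms by (auto simp: near_edge_def opp_opp intro!: bexI[of _ "opp F d"])

lemma edges_subdivision: "edges (subdivision F) = near_edge F ` darts F"
proof -
  let ?edge = "\<lambda>x. {x, opp (subdivision F) x}"
  have "darts (subdivision F) = \<Union>(near_edge F ` darts F)"
    using mem_Union_near_edges[OF subset_refl]
    by (auto simp: near_edge_def opp_in_darts less_2_cases_iff)
  moreover have "?edge x = near_edge F d" if "d \<in> darts F" "x \<in> near_edge F d" for d x
    using that by (auto simp: near_edge_def opp_opp)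
  then have "?edge ` near_edge F d = {near_edge F d}" if "d \<in> darts F" for d
    using that by (auto simp: near_edge_def)
  ultimately show ?thesis by (auto simp: edges_def image_UN)
qed

lemma near_edges_subset: "S \<subseteq> darts F \<Longrightarrow> near_edge F ` S \<subseteq> edges (subdivision F)"
  by (auto simp: edges_subdivision)

lemma num_v_subdivision: "num_v (subdivision F) = num_v F + num_e F"
proof -
  have "Inl ` verts F \<inter> midpoint ` edges F = {}" by auto
  then have "card (verts (subdivision F)) = card (verts F) + card (edges F)"
    unfolding verts_subdivision
    by (simp add: card_Un_disjoint card_image finite_verts finite_edges)
  then show ?thesis by (simp add: num_v_def num_e_def)
qed

lemma card_add_card_empty_edges:
  assumes "S \<subseteq> darts F"
  shows "card S + card (empty_edges F S) = card (full_edges F S) + card (edges F)"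
proof -
  have "S = (\<Union>e\<in>edges F. e \<inter> S)" using assms Union_edges by blast
  then have "card S = card (\<Union>e\<in>edges F. e \<inter> S)" by simp
  also have "\<dots> = (\<Sum>e\<in>edges F. card (e \<inter> S))"
    using partition_onD2[OF partition_on_edges] finite_edges
    by (intro card_UN_disjoint) (auto simp: disjoint_def elim: edgeE)
  finally have "card S + card (empty_edges F S) = (\<Sum>e\<in>edges F. card (e \<inter> S) + of_bool (e \<inter> S = {}))"
    by (simp add: sum.distrib finite_edges empty_edges_def Int_def)
  also have "\<dots> = (\<Sum>e\<in>edges F. of_bool (e \<subseteq> S) + 1)"
  proof (rule sum.cong[OF refl])
    fix e assume "e \<in> edges F"
    then obtain d where "d \<in> darts F" "e = {d, opp F d}" by (rule edgeE)
    then show "card (e \<inter> S) + of_bool (e \<inter> S = {}) = of_bool (e \<subseteq> S) + 1"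
      using opp_neq[of d] by (cases "d \<in> S"; cases "opp F d \<in> S") auto
  qed
  also have "\<dots> = card (full_edges F S) + card (edges F)"
    unfolding sum.distrib by (simp add: finite_edges full_edges_def Int_def)
  finally show ?thesis .
qed

interpretation subdivision: ribbon_graph "subdivision F"
  by (rule ribbon_graph_tensor_cycle)

subsection \<open>Connected components of the states of the subdivided graph\<close>

lemma adjacency_full_state:
  assumes "S \<subseteq> darts F"
  shows "adjacency (full_state F S)
    = (\<lambda>d. (vert F d, vert F (opp F d))) ` {d \<in> S. opp F d \<in> S}"
proof -
  have "\<Union>(full_edges F S) = {d \<in> S. opp F d \<in> S}"
    using mem_Union_full_edges[OF assms] by blast
  then show ?thesis by (simp add: adjacency_def)
qed

lemma adjacency_subdivision_state:
  assumes "S \<subseteq> darts F"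
  shows "adjacency (subdivision_state F S)
    = (\<Union>d\<in>S. {(Inl (vert F d), midpoint {d, opp F d}), (midpoint {d, opp F d}, Inl (vert F d))})"
proof -
  let ?G = "subdivision F"
  have "(\<lambda>x. (vert ?G x, vert ?G (opp ?G x))) ` near_edge F d
      = {(Inl (vert F d), midpoint {d, opp F d}), (midpoint {d, opp F d}, Inl (vert F d))}"
    if "d \<in> S" for d
    using that assms by (auto simp: near_edge_def opp_opp insert_commute subset_iff)
  then show ?thesis by (simp add: adjacency_def image_UN)
qed

lemma component_of_full_state_same_edge:
  assumes S: "S \<subseteq> darts F" and d: "d \<in> S" "d' \<in> S" "{d, opp F d} = {d', opp F d'}"
    and v: "vert F d \<in> component_of (full_state F S) v"
  shows "vert F d' \<in> component_of (full_state F S) v"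
proof -
  from d(3) consider (same) "d' = d" | (opposite) "d' = opp F d" by blast
  then show ?thesis
  proof cases
    case opposite
    then have "(vert F d, vert F d') \<in> adjacency (full_state F S)"
      using d unfolding adjacency_full_state[OF S] by blast
    with v show ?thesis by (rule component_of_step)
  qed (use v in simp)
qed

lemma component_of_subdivision_state_invariant:
  assumes S: "S \<subseteq> darts F" and x: "x \<in> component_of (subdivision_state F S) (Inl v)"
  shows "(\<forall>w. x = Inl w \<longrightarrow> w \<in> component_of (full_state F S) v) \<and>
    (\<forall>d\<in>S. x = midpoint {d, opp F d} \<longrightarrow> vert F d \<in> component_of (full_state F S) v)"
    (is "?invariant x")
proof -
  have "(Inl v, x) \<in> (adjacency (subdivision_state F S))\<^sup>*"
    using x by (simp add: component_of_def)
  then show "?invariant x"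
  proof induction
    case base
    show ?case by (simp add: self_in_component_of)
  next
    case (step x y)
    from step.hyps(2) obtain d where d: "d \<in> S" and
      "(x = Inl (vert F d) \<and> y = midpoint {d, opp F d}) \<or>
        (x = midpoint {d, opp F d} \<and> y = Inl (vert F d))"
      unfolding adjacency_subdivision_state[OF S] by blast
    then consider (to_midpoint) "x = Inl (vert F d)" "y = midpoint {d, opp F d}"
      | (from_midpoint) "x = midpoint {d, opp F d}" "y = Inl (vert F d)"
      by blast
    then show ?case
    proof cases
      case to_midpoint
      then have "vert F d \<in> component_of (full_state F S) v"
        using step.IH by blast
      then show ?thesis
        using to_midpoint component_of_full_state_same_edge[OF S d] by auto
    next
      case from_midpoint
      then show ?thesis using step.IH d by auto
    qed
  qed
qed

lemma Inl_in_component_of_subdivision_state: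
  assumes S: "S \<subseteq> darts F"
  shows "Inl w \<in> component_of (subdivision_state F S) (Inl v)
    \<longleftrightarrow> w \<in> component_of (full_state F S) v"
proof
  show "w \<in> component_of (full_state F S) v"
    if "Inl w \<in> component_of (subdivision_state F S) (Inl v)"
    using component_of_subdivision_state_invariant[OF S that] by simp
next
  assume "w \<in> component_of (full_state F S) v"
  then have "(v, w) \<in> (adjacency (full_state F S))\<^sup>*"
    by (simp add: component_of_def)
  then show "Inl w \<in> component_of (subdivision_state F S) (Inl v)"
  proof induction
    case (step w u)
    then obtain d where d: "d \<in> S" "opp F d \<in> S" "w = vert F d" "u = vert F (opp F d)"
      unfolding adjacency_full_state[OF S] by blast
    then have "{opp F d, opp F (opp F d)} = {d, opp F d}" using S opp_opp by auto
    with d have to_u: "(midpoint {d, opp F d}, Inl u) \<in> adjacency (subdivision_state F S)"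
      unfolding adjacency_subdivision_state[OF S] by (intro UN_I[of "opp F d"]) auto
    have "(Inl w, midpoint {d, opp F d}) \<in> adjacency (subdivision_state F S)"
      using d unfolding adjacency_subdivision_state[OF S] by blast
    with step.IH have "midpoint {d, opp F d} \<in> component_of (subdivision_state F S) (Inl v)"
      by (rule component_of_step)
    from this to_u show ?case by (rule component_of_step)
  qed (rule self_in_component_of)
qed

lemma component_of_subdivision_state_midpoint:
  assumes S: "S \<subseteq> darts F" and e: "e \<in> edges F"
  shows "e \<inter> S = {} \<Longrightarrow> component_of (subdivision_state F S) (midpoint e) = {midpoint e}"
    and "e \<inter> S \<noteq> {} \<Longrightarrow> component_of (subdivision_state F S) (midpoint e) \<inter> Inl ` verts F \<noteq> {}"
proof -
  let ?G = "subdivision_state F S"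
  assume "e \<inter> S = {}"
  then have "midpoint e \<notin> Domain (adjacency ?G)"
    unfolding adjacency_subdivision_state[OF S] by auto
  then show "component_of ?G (midpoint e) = {midpoint e}"
    by (auto simp: component_of_def Not_Domain_rtrancl)
next
  assume "e \<inter> S \<noteq> {}"
  then obtain d where d: "d \<in> S" "e = {d, opp F d}" using e edge_eqI by blast
  then have "(midpoint e, Inl (vert F d)) \<in> adjacency (subdivision_state F S)"
    unfolding adjacency_subdivision_state[OF S] by blast
  with self_in_component_of
  have "Inl (vert F d) \<in> component_of (subdivision_state F S) (midpoint e)"
    by (rule component_of_step)
  moreover have "vert F d \<in> verts F" using d S vert_in_verts by blast
  ultimately show "component_of (subdivision_state F S) (midpoint e) \<inter> Inl ` verts F \<noteq> {}" by blast
qed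

lemma components_subdivision_state_missing:
  assumes S: "S \<subseteq> darts F"
  shows "{C \<in> components (subdivision_state F S). C \<inter> Inl ` verts F = {}}
    = (\<lambda>x. {x}) ` midpoint ` empty_edges F S"
    (is "?missing = ?singletons")
proof (intro subset_antisym subsetI)
  let ?component = "component_of (subdivision_state F S)"
  note midpoint = component_of_subdivision_state_midpoint[OF S]
  show "C \<in> ?singletons" if C: "C \<in> ?missing" for C
  proof -
    from C obtain x where x: "x \<in> Inl ` verts F \<union> midpoint ` edges F" "C = ?component x"
      unfolding components_eq_component_of spanning_sub_simps verts_subdivision by blast
    with C have "x \<notin> Inl ` verts F" using self_in_component_of by fast
    with x obtain e where e: "e \<in> edges F" "C = ?component (midpoint e)" by blast
    with C have "e \<inter> S = {}" using midpoint(2) by blast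
    with e midpoint(1) show ?thesis by (auto simp: empty_edges_def)
  qed
  show "C \<in> ?missing" if "C \<in> ?singletons" for C
  proof -
    from that obtain e where e: "e \<in> edges F" "e \<inter> S = {}" "C = {midpoint e}"
      by (auto simp: empty_edges_def)
    then have "C = ?component (midpoint e)" by (simp add: midpoint(1))
    moreover have "C \<inter> Inl ` verts F = {}" using e(3) by auto
    ultimately show ?thesis
      using e(1) unfolding components_eq_component_of spanning_sub_simps verts_subdivision by blast
  qed
qed

lemma num_k_subdivision_state:
  assumes S: "S \<subseteq> darts F"
  shows "num_k (subdivision_state F S)
    = num_k (full_state F S) + int (card (empty_edges F S))"
proof -
  let ?G = "subdivision_state F S" and ?H = "full_state F S"
  interpret G: ribbon_graph ?G
    using S by (intro subdivision.ribbon_graph_spanning_sub near_edges_subset)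
  interpret H: ribbon_graph ?H
    by (rule ribbon_graph_spanning_sub[OF full_edges_subset])
  have "component_of ?G (Inl v) \<inter> Inl ` verts F = Inl ` component_of ?H v" if "v \<in> verts F" for v
    using H.component_of_subset_verts[of v] that
    by (auto simp: Inl_in_component_of_subdivision_state[OF S])
  then have "(\<lambda>x. component_of ?G x \<inter> Inl ` verts F) ` Inl ` verts F
      = (\<lambda>C. Inl ` C) ` components ?H"
    by (simp add: components_eq_component_of image_image)
  moreover have "card (components ?G) =
      card ((\<lambda>x. component_of ?G x \<inter> Inl ` verts F) ` Inl ` verts F) +
      card {C \<in> components ?G. C \<inter> Inl ` verts F = {}}"
    unfolding components_eq_component_of
    using G.finite_verts G.component_of_eq
    by (intro card_classes_eq_traces_plus_missing)
      (auto simp: self_in_component_of verts_subdivision)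
  ultimately show ?thesis
    by (simp add: num_k_def components_subdivision_state_missing[OF S] card_image inj_on_image)
qed

lemma num_k_subdivision: "num_k (subdivision F) = num_k F"
proof -
  have "full_edges F (darts F) = edges F" "empty_edges F (darts F) = {}"
    using Union_edges by (auto simp: full_edges_def empty_edges_def elim: edgeE)
  moreover have "num_k (spanning_sub F (edges F)) = num_k F"
    by (simp add: num_k_def components_def adjacency_def Union_edges)
  moreover have "num_k (subdivision_state F (darts F)) = num_k (subdivision F)"
    using subdivision.Union_edges
    by (simp add: num_k_def components_def adjacency_def edges_subdivision)
  ultimately show ?thesis
    using num_k_subdivision_state[OF subset_refl] by simp
qed

subsection \<open>Boundary components of the states of the subdivided graph\<close>

lemma boundary_perm_subdivision_state:
  assumes S: "S \<subseteq> darts F" and d: "d \<in> darts F"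
  shows "boundary_perm (subdivision F) (near_edge F ` S) (d, 0)
      = (if d \<in> S then (d, Suc 0) else (rot F d, 0))"
    and "boundary_perm (subdivision F) (near_edge F ` S) (d, Suc 0)
      = (if opp F d \<in> S then (rot F (opp F d), 0) else (opp F d, Suc 0))"
  using mem_Union_near_edges[OF S] d
  by (auto simp: boundary_perm_def perm_restrict_def opp_opp)

lemma induced_rot_boundary_perm_subdivision_state:
  assumes S: "S \<subseteq> darts F" and d: "d \<in> darts F"
  shows "induced_rot (boundary_perm (subdivision F) (near_edge F ` S)) (darts F \<times> {0}) (d, 0)
    = (boundary_perm F (full_edges F S) d, 0)"
proof -
  define \<phi> where "\<phi> = boundary_perm (subdivision F) (near_edge F ` S)"
  define y where "y = boundary_perm F (full_edges F S) d"
  note \<phi>_simps = boundary_perm_subdivision_state[OF S, folded \<phi>_def]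
  note opp = opp_in_darts[OF d] opp_opp[OF d]
  have y_eq: "y = (if d \<in> S \<and> opp F d \<in> S then rot F (opp F d) else rot F d)"
    by (simp add: y_def boundary_perm_def perm_restrict_def mem_Union_full_edges[OF S]
        del: Union_iff)
  have "y \<in> darts F"
    unfolding y_def using bij_betw_boundary_perm[OF full_edges_subset] d by (rule bij_betw_apply)
  \<comment> \<open>Crossing a fully kept edge takes two boundary steps, rounding the tip of a pendant edge three.\<close>
  consider (unkept) "d \<notin> S" | (full) "d \<in> S" "opp F d \<in> S" | (pendant) "d \<in> S" "opp F d \<notin> S"
    by blast
  then have "induced_rot \<phi> (darts F \<times> {0}) (d, 0) = (y, 0)"
  proof cases
    case unkept
    then have "(\<phi> ^^ 1) (d, 0) = (y, 0)" by (simp add: \<phi>_simps y_eq d)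
    then show ?thesis
      using \<open>y \<in> darts F\<close> by (subst induced_rot_eqI[of 1]) auto
  next
    case full
    then have "(\<phi> ^^ 2) (d, 0) = (y, 0)" by (simp add: numeral_2_eq_2 \<phi>_simps y_eq d)
    then show ?thesis
      using d \<open>y \<in> darts F\<close> full
      by (subst induced_rot_eqI[of 2]) (auto simp: \<phi>_simps numeral_2_eq_2 less_Suc_eq)
  next
    case pendant
    then have "(\<phi> ^^ 3) (d, 0) = (y, 0)" by (simp add: numeral_3_eq_3 \<phi>_simps y_eq d opp)
    then show ?thesis
      using d opp \<open>y \<in> darts F\<close> pendant
      by (subst induced_rot_eqI[of 3]) (auto simp: \<phi>_simps numeral_3_eq_3 less_Suc_eq)
  qed
  then show ?thesis by (simp only: \<phi>_def y_def)
qed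

lemma orbit_boundary_perm_subdivision_state_empty_edge:
  assumes "S \<subseteq> darts F" "d \<in> darts F" "d \<notin> S" "opp F d \<notin> S"
  shows "orbit (boundary_perm (subdivision F) (near_edge F ` S)) (d, 1) = {d, opp F d} \<times> {1}"
  using assms
  by (subst orbit_involution) (auto simp: boundary_perm_subdivision_state opp_in_darts opp_opp)

lemma orbit_boundary_perm_subdivision_state_missing:
  assumes S: "S \<subseteq> darts F" and d: "d \<in> darts F"
    and missing: "orbit (boundary_perm (subdivision F) (near_edge F ` S)) (d, 1)
      \<inter> darts F \<times> {0} = {}"
  shows "d \<notin> S" "opp F d \<notin> S"
proof -
  define \<phi> where "\<phi> = boundary_perm (subdivision F) (near_edge F ` S)"
  note \<phi>_simps = boundary_perm_subdivision_state[OF S, folded \<phi>_def]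
  have unkept: "opp F x \<notin> S" if x: "x \<in> darts F" "(x, 1) \<in> orbit \<phi> (d, 1)" for x
  proof
    assume "opp F x \<in> S"
    then have "(rot F (opp F x), 0) \<in> orbit \<phi> (d, 1)"
      using orbit.step[OF x(2)] x(1) by (simp add: \<phi>_simps)
    moreover have "rot F (opp F x) \<in> darts F"
      using bij_betw_rot opp_in_darts[OF x(1)] by (rule bij_betw_apply)
    ultimately show False using missing unfolding \<phi>_def by blast
  qed
  have "(d, 1) \<in> orbit \<phi> (d, 1)"
    unfolding \<phi>_def
    using subdivision.finite_darts subdivision.bij_betw_boundary_perm[OF near_edges_subset[OF S]]
    by (rule bij_betw_self_in_orbit) (use d in simp)
  with d show opp_d: "opp F d \<notin> S" by (rule unkept)
  then have "(opp F d, 1) \<in> orbit \<phi> (d, 1)"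
    using orbit.base[of \<phi> "(d, 1)"] d by (simp add: \<phi>_simps)
  with unkept[OF opp_in_darts] d show "d \<notin> S" by (simp add: opp_opp)
qed

lemma orbits_boundary_perm_subdivision_state_missing:
  assumes S: "S \<subseteq> darts F"
  shows "{C \<in> orbit (boundary_perm (subdivision F) (near_edge F ` S)) ` darts (subdivision F).
      C \<inter> darts F \<times> {0} = {}} = (\<lambda>e. e \<times> {1}) ` empty_edges F S"
    (is "?missing = ?loops")
proof (intro subset_antisym subsetI)
  let ?\<phi> = "boundary_perm (subdivision F) (near_edge F ` S)"
  note loop = orbit_boundary_perm_subdivision_state_empty_edge[OF S]
  show "C \<in> ?loops" if "C \<in> ?missing" for C
  proof -
    from that obtain d i where d: "d \<in> darts F" "i < 2"
      and C: "C = orbit ?\<phi> (d, i)" "C \<inter> darts F \<times> {0} = {}"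
      by auto
    have "(d, i) \<in> C"
      unfolding C(1)
      using subdivision.finite_darts subdivision.bij_betw_boundary_perm[OF near_edges_subset[OF S]]
      by (rule bij_betw_self_in_orbit) (use d in simp)
    with d C(2) have "i = 1" by (auto simp: less_2_cases_iff)
    with C have C_eq: "C = orbit ?\<phi> (d, 1)" by simp
    note unkept = orbit_boundary_perm_subdivision_state_missing[OF S d(1) C(2)[unfolded C_eq]]
    then have "{d, opp F d} \<in> empty_edges F S"
      using d(1) by (simp add: empty_edges_def edge_of_dart)
    then show ?thesis unfolding C_eq loop[OF d(1) unkept] by (rule imageI)
  qed
  show "C \<in> ?missing" if "C \<in> ?loops" for C
  proof -
    from that obtain d where "d \<in> darts F" "d \<notin> S" "opp F d \<notin> S" "C = {d, opp F d} \<times> {1}"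
      by (auto simp: empty_edges_def elim: edgeE)
    then show ?thesis using loop by (auto intro!: image_eqI[of _ _ "(d, 1)"])
  qed
qed

lemma num_p_subdivision_state:
  assumes S: "S \<subseteq> darts F"
  shows "num_p (subdivision_state F S)
    = num_p (full_state F S) + int (card (empty_edges F S))"
proof -
  let ?\<phi> = "boundary_perm (subdivision F) (near_edge F ` S)" and ?B = "darts F \<times> {0::nat}"
  let ?\<psi> = "boundary_perm F (full_edges F S)"
  note near = near_edges_subset[OF S]
  have "orbit (induced_rot ?\<phi> ?B) (d, 0) = (\<lambda>d. (d, 0)) ` orbit ?\<psi> d" if d: "d \<in> darts F" for d
  proof (rule orbit_inverse[symmetric])
    note bij = bij_betw_boundary_perm[OF full_edges_subset]
    show "d \<in> orbit ?\<psi> d" using finite_darts bij d by (rule bij_betw_self_in_orbit)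
    fix x assume "x \<in> orbit ?\<psi> d"
    then have "x \<in> darts F"
      using orbit_subset_of_funcset[OF bij_betw_imp_funcset[OF bij] d] by blast
    then show "induced_rot ?\<phi> ?B (x, 0) = (?\<psi> x, 0)"
      by (rule induced_rot_boundary_perm_subdivision_state[OF S])
  qed
  moreover have "?B = (\<lambda>d. (d, 0)) ` darts F" by auto
  ultimately have "orbit (induced_rot ?\<phi> ?B) ` ?B = (\<lambda>C. (\<lambda>d. (d, 0)) ` C) ` orbit ?\<psi> ` darts F"
    by (simp add: image_image)
  moreover have "inj_on (\<lambda>C. (\<lambda>d. (d, 0::nat)) ` C) (orbit ?\<psi> ` darts F)"
    by (rule inj_on_image) (simp add: inj_on_def)
  moreover have "inj_on (\<lambda>e. e \<times> {1::nat}) (empty_edges F S)"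
    by (rule inj_onI) auto
  moreover have "isolated_verts (subdivision F) = Inl ` isolated_verts F"
    by (rule isolated_verts_tensor_cycle) simp
  moreover have "?B \<subseteq> darts (subdivision F)" by auto
  moreover note card_orbits_induced_rot[OF subdivision.finite_darts
      subdivision.bij_betw_boundary_perm[OF near] this]
  ultimately show ?thesis
    unfolding subdivision.num_p_spanning_sub[OF near] num_p_spanning_sub[OF full_edges_subset]
      orbits_boundary_perm_subdivision_state_missing[OF S]
    by (simp add: card_image)
qed

subsection \<open>The state sum\<close>

lemma BR_poly_subdivision_eq_sum_Pow_darts:
  "BR_poly (subdivision F) a b c
    = (\<Sum>S\<in>Pow (darts F). state_weight a b c (subdivision F) (subdivision_state F S))"
proof -
  have "Pow (edges (subdivision F)) = image (near_edge F) ` Pow (darts F)"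
    unfolding edges_subdivision by (rule image_Pow_surj[symmetric]) (rule refl)
  moreover have "inj_on (image (near_edge F)) (Pow (darts F))"
    by (rule inj_on_image) (rule inj_on_near_edge)
  ultimately show ?thesis
    by (simp add: subdivision.BR_poly_eq_sum_Pow_edges sum.reindex)
qed

lemma num_e_subdivision_state:
  assumes "S \<subseteq> darts F"
  shows "num_e (subdivision_state F S) = int (card S)"
  using subdivision.num_e_spanning_sub[OF near_edges_subset[OF assms]]
  by (simp add: card_image inj_on_near_edge)

lemma state_weight_subdivision_state:
  assumes S: "S \<subseteq> darts F" and "a \<noteq> 0"
  shows "state_weight a b c (subdivision F) (subdivision_state F S)
    = a ^ card (empty_edges F S) * state_weight a b c F (full_state F S)"
proof -
  let ?G = "subdivision_state F S" and ?H = "full_state F S"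
  note k = num_k_subdivision_state[OF S]
  have "num_e ?G + int (card (empty_edges F S)) = num_e ?H + num_e F"
    unfolding num_e_subdivision_state[OF S] num_e_spanning_sub[OF full_edges_subset]
    using card_add_card_empty_edges[OF S] by (simp add: num_e_def)
  moreover have "num_v ?G = num_v ?H + num_e F"
    by (simp only: num_v_spanning_sub subdivision.num_v_spanning_sub num_v_subdivision)
  ultimately have "nul ?G = nul ?H"
    using k by (simp add: nul_def rk_def)
  moreover have "rk (subdivision F) - rk ?G = int (card (empty_edges F S)) + (rk F - rk ?H)"
    using k num_k_subdivision
    by (simp add: rk_def num_v_spanning_sub subdivision.num_v_spanning_sub)
  moreover have "num_k ?G - num_p ?G = num_k ?H - num_p ?H"
    using k num_p_subdivision_state[OF S] by simp
  ultimately show ?thesis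
    using \<open>a \<noteq> 0\<close> by (simp add: state_weight_def power_int_add)
qed

lemma state_weight_rescale:
  assumes A: "A \<subseteq> edges F" and "q \<noteq> 0"
  shows "q ^ card (edges F - A) * state_weight a b c F (spanning_sub F A)
    = q powi nul F * state_weight (a * q) (b / q) c F (spanning_sub F A)"
proof -
  let ?H = "spanning_sub F A"
  have "int (card (edges F - A)) = num_e F - num_e ?H"
    unfolding num_e_spanning_sub[OF A]
    using A finite_subset[OF A finite_edges] card_mono[OF finite_edges A]
    by (simp add: num_e_def card_Diff_subset of_nat_diff)
  then have "int (card (edges F - A)) = nul F + (rk F - rk ?H) - nul ?H"
    by (simp add: nul_def)
  then have "q ^ card (edges F - A) = q powi nul F * q powi (rk F - rk ?H) / q powi nul ?H"
    using \<open>q \<noteq> 0\<close> by (simp add: power_int_add power_int_diff flip: power_int_of_nat)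
  then show ?thesis
    by (simp add: state_weight_def power_int_mult_distrib power_int_divide_distrib)
qed

lemma prod_edge_weights:
  fixes a :: "'a::comm_semiring_1"
  assumes "A \<subseteq> edges F"
  shows "(\<Prod>e\<in>edges F. of_bool (S \<inter> e = e \<longleftrightarrow> e \<in> A) * (if S \<inter> e = {} then a else 1))
    = of_bool (full_edges F S = A) * a ^ card (empty_edges F S)"
proof -
  have "(\<forall>e\<in>edges F. S \<inter> e = e \<longleftrightarrow> e \<in> A) \<longleftrightarrow> full_edges F S = A"
    using assms by (auto simp: full_edges_def)
  moreover have "(\<Prod>e\<in>edges F. if S \<inter> e = {} then a else 1) = a ^ card (empty_edges F S)"
    using finite_edges by (simp add: prod.If_cases empty_edges_def Int_def conj_commute Int_commute)
  ultimately show ?thesis by (simp add: prod.distrib prod_of_bool finite_edges)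
qed

lemma sum_edge_weights:
  fixes a :: "'a::comm_semiring_1"
  assumes "e \<in> edges F"
  shows "(\<Sum>Y\<in>Pow e. of_bool (Y = e \<longleftrightarrow> e \<in> A) * (if Y = {} then a else 1))
    = (if e \<in> A then 1 else a + 2)"
proof -
  obtain d where d: "d \<in> darts F" "e = {d, opp F d}" using assms by (rule edgeE)
  have "Pow e = {{}, {d}, {opp F d}, {d, opp F d}}" unfolding d by blast
  then show ?thesis
    using d opp_neq[OF d(1)] opp_neq[OF d(1), symmetric]
    by (auto simp: doubleton_eq_iff algebra_simps)
qed

lemma sum_power_card_empty_edges:
  fixes a :: "'a::comm_semiring_1"
  assumes A: "A \<subseteq> edges F"
  shows "(\<Sum>S | S \<in> Pow (darts F) \<and> full_edges F S = A. a ^ card (empty_edges F S))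
    = (a + 2) ^ card (edges F - A)"
proof -
  have "(\<Sum>S | S \<in> Pow (darts F) \<and> full_edges F S = A. a ^ card (empty_edges F S))
      = (\<Sum>S\<in>Pow (darts F). of_bool (full_edges F S = A) * a ^ card (empty_edges F S))"
    using finite_darts by (intro sum.mono_neutral_cong_left) auto
  also have "\<dots> = (\<Prod>e\<in>edges F. \<Sum>Y\<in>Pow e. of_bool (Y = e \<longleftrightarrow> e \<in> A) * (if Y = {} then a else 1))"
    unfolding prod_edge_weights[OF A, symmetric] using finite_darts partition_on_edges
    by (rule sum_Pow_partition)
  also have "\<dots> = (\<Prod>e\<in>edges F. if e \<in> A then 1 else a + 2)"
    by (intro prod.cong refl sum_edge_weights)
  also have "\<dots> = (a + 2) ^ card (edges F - A)"
    by (simp add: prod.If_cases finite_edges Diff_eq)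
  finally show ?thesis .
qed

lemma BR_poly_subdivision:
  assumes "a \<noteq> 0" and "a + 2 \<noteq> 0"
  shows "BR_poly (subdivision F) a b c
    = (a + 2) powi nul F * BR_poly F (a * (a + 2)) (b / (a + 2)) c"
proof -
  let ?H = "spanning_sub F"
  have "BR_poly (subdivision F) a b c
      = (\<Sum>S\<in>Pow (darts F). a ^ card (empty_edges F S) * state_weight a b c F (full_state F S))"
    unfolding BR_poly_subdivision_eq_sum_Pow_darts
    using \<open>a \<noteq> 0\<close> by (intro sum.cong refl state_weight_subdivision_state) auto
  also have "\<dots> = (\<Sum>A\<in>Pow (edges F). \<Sum>S | S \<in> Pow (darts F) \<and> full_edges F S = A.
      a ^ card (empty_edges F S) * state_weight a b c F (full_state F S))"
    using finite_darts finite_edges full_edges_subset by (intro sum.group[symmetric]) auto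
  also have "\<dots> = (\<Sum>A\<in>Pow (edges F). (a + 2) ^ card (edges F - A) * state_weight a b c F (?H A))"
    by (intro sum.cong refl) (simp flip: sum_power_card_empty_edges add: sum_distrib_right)
  also have "\<dots> = (\<Sum>A\<in>Pow (edges F).
      (a + 2) powi nul F * state_weight (a * (a + 2)) (b / (a + 2)) c F (?H A))"
    using \<open>a + 2 \<noteq> 0\<close> by (intro sum.cong refl state_weight_rescale) auto
  also have "\<dots> = (a + 2) powi nul F * BR_poly F (a * (a + 2)) (b / (a + 2)) c"
    by (simp add: BR_poly_eq_sum_Pow_edges sum_distrib_left)
  finally show ?thesis .
qed

end

theorem theorem5p2:
  fixes F :: "('v, 'd) pre_ribbon_graph" and \<alpha> \<beta> \<gamma> s :: complex
  assumes "ribbon_graph F"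
    and "\<alpha> \<noteq> - 2" and "\<alpha> \<noteq> 0" and "\<alpha> \<noteq> 1"
    and "\<beta> = \<alpha> * (1 - \<alpha>)"
    and "s\<^sup>2 = \<alpha> * \<beta>" and "\<gamma> = 1 / s"
  shows "BR_poly (tensor_cycle F 3) \<alpha> \<beta> \<gamma>
         = (\<alpha> + 2) powi nul F * BR_poly F (\<alpha> * (\<alpha> + 2)) (\<beta> / (\<alpha> + 2)) \<gamma>"
proof -
  have "\<alpha> + 2 \<noteq> 0" using \<open>\<alpha> \<noteq> - 2\<close> by (simp add: add_eq_0_iff2)
  with \<open>ribbon_graph F\<close> \<open>\<alpha> \<noteq> 0\<close> show ?thesis
    by (rule ribbon_graph.BR_poly_subdivision)
qed

end
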